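(* Let $\mathfrak g$ be of type $D_4^{(3)}$ and $\lambda=\Lambda_0$, or of type $G_2^{(1)}$ and $\lambda\in\{\Lambda_0,\Lambda_2\}$. Let $\mathcal Y(\lambda)$ be the set of reduced Young walls built on the ground-state wall $Y_\lambda$. Then for any $Y\in\mathcal Y(\lambda)$ and any $i\in\{0,1,2\}$ we have $$\tilde E_iY\in\mathcal Y(\lambda)\cup\{0\},\qquad \tilde F_iY\in\mathcal Y(\lambda)\cup\{0\}.$$
   Context: $\Lambda_i$ denote the fundamental weights; $\Lambda_0$ (type $D_4^{(3)}$), resp. $\Lambda_0,\Lambda_2$ (type $G_2^{(1)}$), are the level-1 dominant integral weights. **Blocks (column pattern).** A column is built from colored blocks stacked in rows indexed by $\mathbb Z$ (the pictures of the paper encoded by labels; a label determines a position in the column). Type $D_4^{(3)}$: for each $n\in\mathbb Z$, row $2n$ contains a $0$-block $Z_n$ and a $2$-block $W_n$; row $2n+1$ contains two $1$-blocks $P_n$ (the one lying over $Z_n$) and $Q_n$ (the other one). Type $G_2^{(1)}$: for each $n\in\mathbb Z$, row $2n$ contains a $0$-block $Z_n$ and two $2$-blocks $A_n,B_n$ (with $B_n$ resting partly on $A_n$); row $2n+1$ contains two $1$-blocks $X_n,Y_n$ ($Y_n$ lying over $Z_n$) and a $2$-block $V_n$ lying on top of $Y_n$. Let $J_n$ be the set of all blocks in rows $\le 2n-1$. **Young columns.** These are exactly the following sets of blocks ($n\in\mathbb Z$ arbitrary). Type $D_4^{(3)}$: class $c_1$: $J_n\cup\{Z_n,W_n,Q_n,Z_{n+1}\}$;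 $c_2$: $J_n\cup\{Z_n\}$; $c_3$: $J_n\cup\{Z_n,W_n\}$; $c_0$: $J_n\cup\{Z_n,W_n,P_n\}$; $c_{\bar3}$: $J_n$; $c_{\bar2}$: $J_n\cup\{W_n\}$; $c_{\bar1}$: $J_n\cup\{W_n,Q_n\}$; $c_\phi$: $J_n\cup\{W_n,Q_n,Z_{n+1}\}$. Type $G_2^{(1)}$: $c'_1$: $J_n\cup\{Z_n,A_n,B_n,X_n,Z_{n+1}\}$; $c'_2$: $J_n\cup\{Z_n,A_n,B_n,X_n,Y_n,Z_{n+1}\}$; $c'_3$: $J_n\cup\{Z_n\}$; $c'_4$: $J_n\cup\{Z_n,A_n\}$; $c'_5$: $J_n\cup\{Z_n,A_n,Y_n\}$; $c'_6$: $J_n\cup\{Z_n,A_n,B_n\}$; $c'_7$: $J_n\cup\{Z_n,A_n,B_n,Y_n\}$; $c'_{\bar7}$: $J_n\cup\{Z_n,A_n,Y_n,V_n\}$; $c'_{\bar6}$: $J_n\cup\{Z_n,A_n,B_n,Y_n,X_n\}$; $c'_{\bar5}$: $J_n\cup\{Z_n,A_n,B_n,Y_n,V_n\}$; $c'_{\bar4}$: $J_n$; $c'_{\bar3}$: $J_n\cup\{A_n\}$; $c'_{\bar2}$: $J_n\cup\{A_n,B_n\}$; $c'_{\bar1}$: $J_n\cup\{A_n,B_n,X_n\}$; $c'_0$: $J_n\cup\{A_n,B_n,X_n,Z_{n+1}\}$. Two Young columns are equivalent iff they have the same class name (differ by a shift of $n$; geometrically, up to vertical position and $180^\circ$ horizontal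 rotation). $C_1$ (resp. $C'_1$) is the set of the 8 (resp. 15) classes. **Signatures of columns.** $\mathrm{sign}_i(y)=(-,\dots,-,+,\dots,+)$ with $r$ minus signs and $a$ plus signs, written $(r,a)$; pairs not listed are $(0,0)$. $D_4^{(3)}$, classes by subscript. $\mathrm{sign}_0$: $1:(2,0)$; $2,3:(1,0)$; $\bar3,\bar2:(0,1)$; $\bar1:(0,2)$; $\phi:(1,1)$. $\mathrm{sign}_1$: $1:(0,1)$; $2:(1,0)$; $3:(0,2)$; $0:(1,1)$; $\bar3:(2,0)$; $\bar2:(0,1)$; $\bar1:(1,0)$. $\mathrm{sign}_2$: $2:(0,1)$; $3:(1,0)$; $\bar3:(0,1)$; $\bar2:(1,0)$. $G_2^{(1)}$. $\mathrm{sign}_0$: $1:(2,0)$; $2,3,4,6:(1,0)$; $\bar6,\bar4,\bar3,\bar2:(0,1)$; $\bar1:(0,2)$; $0:(1,1)$. $\mathrm{sign}_1$: $1:(0,1)$; $2:(1,0)$; $4:(0,1)$; $5:(1,0)$; $6:(0,2)$; $7:(1,1)$; $\bar6:(2,0)$; $\bar5:(0,1)$; $\bar4:(1,0)$; $\bar2:(0,1)$; $\bar1:(1,0)$. $\mathrm{sign}_2$: $2:(0,3)$; $3:(1,2)$; $4:(2,1)$; $6:(3,0)$; $5:(0,2)$; $\bar7:(1,1)$; $\bar5:(2,0)$; $\bar6:(0,3)$; $\bar4:(1,2)$; $\bar3:(2,1)$; $\bar2:(3,0)$. "Adding (removing) an $i$-block" to (from) a Young column means passing to the unique Young column obtained by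 adding (removing) a single $i$-block; by convention, in type $G_2^{(1)}$ no $2$-block may be added to or removed from a column of class $c'_7$, and no $2$-block may be added or removed so as to reach a column of class $c'_7$. **Energy function.** For classes $x,y$, $H(x\otimes y)\in\{0,1,2\}$ is as follows. $D_4^{(3)}$: put $A_0=\{c_0,c_1,c_2,c_3\}$, $\bar A_0=\{c_0,c_{\bar1},c_{\bar2},c_{\bar3}\}$, $A_1=C_1\setminus\{c_\phi\}$, $A_2=\{c_2,c_3,c_0,c_{\bar3},c_{\bar2}\}$, $A_3=\{c_3,c_0,c_{\bar3}\}$; $\mathbf A=\{(c_\phi,c_\phi),(c_2,c_{\bar2})\}\cup A_0\times\{c_{\bar1}\}\cup\{c_1\}\times\bar A_0$; $\mathbf B=\bigcup_{i=1}^3(A_i\times\{c_i\}\cup\{c_{\bar i}\}\times A_i)$. Then $H=0$ on $\mathbf A$, $2$ on $\mathbf B$, $1$ otherwise. $G_2^{(1)}$: put $D_0=\{c'_1,c'_2,c'_3,c'_4,c'_5,c'_{\bar7}\}$, $\bar D_0=\{c'_{\bar1},c'_{\bar2},c'_{\bar3},c'_{\bar4},c'_{\bar5},c'_{\bar7}\}$, $D'_0=\{c'_5,c'_7,c'_{\bar6}\}$, $\bar D'_0=\{c'_6,c'_7,c'_{\bar5}\}$, $D_1=\bar D_1=C'_1\setminus\{c'_0\}$, $D_2=\bar D_2=C'_1\setminus\{c'_0,c'_1,c'_{\bar1}\}$, $D_3=\{c'_{\bar5},c'_6,c'_7,c'_{\bar6},c'_{\bar4},c'_{\bar3}\}$,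 $\bar D_3=\{c'_{\bar6},c'_5,c'_7,c'_6,c'_4,c'_3\}$, $D_4=D_3\setminus\{c'_{\bar3}\}$, $\bar D_4=\bar D_3\setminus\{c'_3\}$, $D_5=\{c'_{\bar6}\}$, $\bar D_5=\{c'_6\}$, $D_6=\bar D_6=\{c'_6,c'_7,c'_{\bar6}\}$; $\mathbf X=\{(c'_0,c'_0)\}\cup D_0\times\bar D_0\cup\{c'_1\}\times D'_0\cup\bar D'_0\times\{c'_{\bar1}\}$; $\mathbf Y=\bigcup_{i=1}^6(D_i\times\{c'_i\}\cup\{c'_{\bar i}\}\times\bar D_i)$. Then $H=0$ on $\mathbf X$, $2$ on $\mathbf Y$, $1$ otherwise. **Young walls.** The ground-state wall $Y_\lambda$ is the sequence $(\dots,g,g,g)$ with every column equal to the ground-state column $g$: for $D_4^{(3)}$, $\lambda=\Lambda_0$: $g=J_0\cup\{W_0,Q_0,Z_1\}$ (class $c_\phi$); for $G_2^{(1)}$, $\lambda=\Lambda_0$: $g=J_0\cup\{A_0,B_0,X_0,Z_1\}$ (class $c'_0$); for $G_2^{(1)}$, $\lambda=\Lambda_2$: $g=J_1\cup\{Z_1,A_1,Y_1,V_1\}$ (class $c'_{\bar7}$). A Young wall built on $Y_\lambda$ is a sequence $Y=(\dots,y_2,y_1,y_0)$ of Young columns such that $g\subseteq y_k$ for all $k\geq0$, $y_k=g$ for $k\gg0$ (finitely many blocks are added), and $y_{k+1}\subseteq y_k$ for all $k$ (each block of the left column has a block in the same position in the right column). $|y_k|_0$ is the number of $0$-blocks of $y_k\setminus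 g$. $Y$ is reduced if $H(y_{k+1}\otimes y_k)+|y_{k+1}|_0-|y_k|_0=0$ for all $k\ge0$, where $H$ is evaluated on the classes of the columns. $\mathcal Y(\lambda)$ is the set of reduced Young walls built on $Y_\lambda$. **Operators on walls.** The $i$-signature of $Y$ is obtained from the sequence of signs $(\dots,\mathrm{sign}_i(y_1),\mathrm{sign}_i(y_0))$ by cancelling every $(+,-)$ pair ($+$ to the left of $-$), leaving a finite sequence of $-$'s followed by $+$'s. $\tilde E_iY$ is obtained by removing an $i$-block from the column corresponding to the right-most $-$ of the $i$-signature ($\tilde E_iY=0$ if there is no $-$). $\tilde F_iY$ is obtained by adding an $i$-block to the column corresponding to the left-most $+$ ($\tilde F_iY=0$ if there is no $+$). *)

theory Defs
  imports Main
begin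

datatype fundamental_weight = Lambda0 | Lambda1 | Lambda2

text \<open>
  The data by which the two types differ. A Young column is a set of blocks; the columns of
  class \<open>c\<close> are \<open>column P c n\<close> for integer \<open>n\<close>. \<open>sign P i c = (r, a)\<close> stands for \<open>r\<close> minus signs
  followed by \<open>a\<close> plus signs. \<open>permitted P i c c'\<close> says that an \<open>i\<close>-block may be added to a column of
  class \<open>c\<close> to reach a column of class \<open>c'\<close> (equivalently, removed from the latter to reach the
  former); it encodes the convention on the class \<open>c'_7\<close> in type G.
\<close>

record ('b, 'c) wall_pattern =
  colour :: "'b \<Rightarrow> nat"
  column :: "'c \<Rightarrow> int \<Rightarrow> 'b set"
  sign :: "nat \<Rightarrow> 'c \<Rightarrow> nat \<times> nat"
  permitted :: "nat \<Rightarrow> 'c \<Rightarrow> 'c \<Rightarrow> bool"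
  energy :: "'c \<Rightarrow> 'c \<Rightarrow> int"
  ground :: "fundamental_weight \<Rightarrow> 'b set"

section \<open>Columns\<close>

definition young_column :: "('b, 'c) wall_pattern \<Rightarrow> 'b set \<Rightarrow> bool" where
  "young_column P y \<longleftrightarrow> (\<exists>c n. y = column P c n)"

definition class_of :: "('b, 'c) wall_pattern \<Rightarrow> 'b set \<Rightarrow> 'c" where
  "class_of P y = (THE c. \<exists>n. y = column P c n)"

definition block_step :: "('b, 'c) wall_pattern \<Rightarrow> nat \<Rightarrow> 'b set \<Rightarrow> 'b set \<Rightarrow> bool" where
  "block_step P i y y' \<longleftrightarrow> young_column P y \<and> young_column P y' \<and>
     (\<exists>b. b \<notin> y \<and> colour P b = i \<and> y' = insert b y) \<and>
     permitted P i (class_of P y) (class_of P y')"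

definition add_block :: "('b, 'c) wall_pattern \<Rightarrow> nat \<Rightarrow> 'b set \<Rightarrow> 'b set" where
  "add_block P i y = (THE y'. block_step P i y y')"

definition remove_block :: "('b, 'c) wall_pattern \<Rightarrow> nat \<Rightarrow> 'b set \<Rightarrow> 'b set" where
  "remove_block P i y = (THE y'. block_step P i y' y)"

section \<open>Young walls\<close>

text \<open>A wall \<open>(\<dots>, y\<^sub>2, y\<^sub>1, y\<^sub>0)\<close> is a function on \<open>nat\<close>; larger indices are further to the left.\<close>

definition young_wall ::
    "('b, 'c) wall_pattern \<Rightarrow> fundamental_weight \<Rightarrow> (nat \<Rightarrow> 'b set) \<Rightarrow> bool" where
  "young_wall P lam Y \<longleftrightarrow>
     (\<forall>k. young_column P (Y k)) \<and>
     (\<forall>k. ground P lam \<subseteq> Y k) \<and>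
     (\<exists>K. \<forall>k\<ge>K. Y k = ground P lam) \<and>
     (\<forall>k. Y (Suc k) \<subseteq> Y k)"

definition zero_count :: "('b, 'c) wall_pattern \<Rightarrow> fundamental_weight \<Rightarrow> 'b set \<Rightarrow> int" where
  "zero_count P lam y = int (card {b \<in> y - ground P lam. colour P b = 0})"

definition reduced_walls ::
    "('b, 'c) wall_pattern \<Rightarrow> fundamental_weight \<Rightarrow> (nat \<Rightarrow> 'b set) set" where
  "reduced_walls P lam = {Y. young_wall P lam Y \<and>
     (\<forall>k. energy P (class_of P (Y (Suc k))) (class_of P (Y k))
          + zero_count P lam (Y (Suc k)) - zero_count P lam (Y k) = 0)}"

section \<open>Signatures and operators\<close>

text \<open>The position \<open>(k, j)\<close> is that of the \<open>j\<close>-th sign, counted from the left, of column \<open>k\<close>.\<close>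

definition left_of :: "nat \<times> nat \<Rightarrow> nat \<times> nat \<Rightarrow> bool" where
  "left_of p q \<longleftrightarrow> fst p > fst q \<or> (fst p = fst q \<and> snd p < snd q)"

definition minus_at ::
    "('b, 'c) wall_pattern \<Rightarrow> nat \<Rightarrow> (nat \<Rightarrow> 'b set) \<Rightarrow> nat \<times> nat \<Rightarrow> bool" where
  "minus_at P i Y p \<longleftrightarrow> (case sign P i (class_of P (Y (fst p))) of (r, a) \<Rightarrow> snd p < r)"

definition plus_at ::
    "('b, 'c) wall_pattern \<Rightarrow> nat \<Rightarrow> (nat \<Rightarrow> 'b set) \<Rightarrow> nat \<times> nat \<Rightarrow> bool" where
  "plus_at P i Y p \<longleftrightarrow>
     (case sign P i (class_of P (Y (fst p))) of (r, a) \<Rightarrow> r \<le> snd p \<and> snd p < r + a)"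

text \<open>
  \<open>cancels P i Y p q\<close>: the plus at \<open>p\<close> and the minus at \<open>q\<close> become adjacent, and so form a
  cancelled pair, once all signs strictly between them have been cancelled among themselves.
  This makes sense although the sequence of signs may be infinite to the left.
\<close>

inductive cancels ::
    "('b, 'c) wall_pattern \<Rightarrow> nat \<Rightarrow> (nat \<Rightarrow> 'b set) \<Rightarrow> nat \<times> nat \<Rightarrow> nat \<times> nat \<Rightarrow> bool"
  for P i Y where
  "\<lbrakk>plus_at P i Y p; minus_at P i Y q; left_of p q;
    \<forall>s. left_of p s \<and> left_of s q \<and> (plus_at P i Y s \<or> minus_at P i Y s) \<longrightarrow>
      (\<exists>t. left_of p t \<and> left_of t q \<and> (cancels P i Y s t \<or> cancels P i Y t s))\<rbrakk>
   \<Longrightarrow> cancels P i Y p q"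

definition signature_minus ::
    "('b, 'c) wall_pattern \<Rightarrow> nat \<Rightarrow> (nat \<Rightarrow> 'b set) \<Rightarrow> nat \<Rightarrow> bool" where
  "signature_minus P i Y k \<longleftrightarrow> (\<exists>j. minus_at P i Y (k, j) \<and> (\<nexists>p. cancels P i Y p (k, j)))"

definition signature_plus ::
    "('b, 'c) wall_pattern \<Rightarrow> nat \<Rightarrow> (nat \<Rightarrow> 'b set) \<Rightarrow> nat \<Rightarrow> bool" where
  "signature_plus P i Y k \<longleftrightarrow> (\<exists>j. plus_at P i Y (k, j) \<and> (\<nexists>q. cancels P i Y (k, j) q))"

text \<open>
  The value \<open>0\<close> of the operators is \<open>None\<close>. The right-most column is the one of least index.
\<close>

definition E_tilde ::
    "('b, 'c) wall_pattern \<Rightarrow> nat \<Rightarrow> (nat \<Rightarrow> 'b set) \<Rightarrow> (nat \<Rightarrow> 'b set) option" where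
  "E_tilde P i Y =
     (if \<exists>k. signature_minus P i Y k
      then let k = (LEAST k. signature_minus P i Y k) in Some (Y(k := remove_block P i (Y k)))
      else None)"

definition F_tilde ::
    "('b, 'c) wall_pattern \<Rightarrow> nat \<Rightarrow> (nat \<Rightarrow> 'b set) \<Rightarrow> (nat \<Rightarrow> 'b set) option" where
  "F_tilde P i Y =
     (if \<exists>k. signature_plus P i Y k
      then let k = (GREATEST k. signature_plus P i Y k) in Some (Y(k := add_block P i (Y k)))
      else None)"

section \<open>Type \<open>D\<^sub>4\<^sup>(\<^sup>3\<^sup>)\<close>\<close>

datatype D_block = DZ int | DW int | DP int | DQ int

fun D_row :: "D_block \<Rightarrow> int" where
  "D_row (DZ n) = 2 * n"
| "D_row (DW n) = 2 * n"
| "D_row (DP n) = 2 * n + 1"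
| "D_row (DQ n) = 2 * n + 1"

fun D_colour :: "D_block \<Rightarrow> nat" where
  "D_colour (DZ n) = 0"
| "D_colour (DW n) = 2"
| "D_colour (DP n) = 1"
| "D_colour (DQ n) = 1"

definition D_J :: "int \<Rightarrow> D_block set" where
  "D_J n = {b. D_row b \<le> 2 * n - 1}"

text \<open>The constructor \<open>cb_i\<close> is the barred class.\<close>

datatype D_class = c_1 | c_2 | c_3 | c_0 | cb_3 | cb_2 | cb_1 | c_phi

fun D_column :: "D_class \<Rightarrow> int \<Rightarrow> D_block set" where
  "D_column c_1 n = D_J n \<union> {DZ n, DW n, DQ n, DZ (n + 1)}"
| "D_column c_2 n = D_J n \<union> {DZ n}"
| "D_column c_3 n = D_J n \<union> {DZ n, DW n}"
| "D_column c_0 n = D_J n \<union> {DZ n, DW n, DP n}"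
| "D_column cb_3 n = D_J n"
| "D_column cb_2 n = D_J n \<union> {DW n}"
| "D_column cb_1 n = D_J n \<union> {DW n, DQ n}"
| "D_column c_phi n = D_J n \<union> {DW n, DQ n, DZ (n + 1)}"

definition D_sign :: "nat \<Rightarrow> D_class \<Rightarrow> nat \<times> nat" where
  "D_sign i c =
     (if i = 0 then
        (case c of c_1 \<Rightarrow> (2, 0) | c_2 \<Rightarrow> (1, 0) | c_3 \<Rightarrow> (1, 0) | cb_3 \<Rightarrow> (0, 1)
         | cb_2 \<Rightarrow> (0, 1) | cb_1 \<Rightarrow> (0, 2) | c_phi \<Rightarrow> (1, 1) | _ \<Rightarrow> (0, 0))
      else if i = 1 then
        (case c of c_1 \<Rightarrow> (0, 1) | c_2 \<Rightarrow> (1, 0) | c_3 \<Rightarrow> (0, 2) | c_0 \<Rightarrow> (1, 1)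
         | cb_3 \<Rightarrow> (2, 0) | cb_2 \<Rightarrow> (0, 1) | cb_1 \<Rightarrow> (1, 0) | _ \<Rightarrow> (0, 0))
      else if i = 2 then
        (case c of c_2 \<Rightarrow> (0, 1) | c_3 \<Rightarrow> (1, 0) | cb_3 \<Rightarrow> (0, 1) | cb_2 \<Rightarrow> (1, 0)
         | _ \<Rightarrow> (0, 0))
      else (0, 0))"

definition D_A0 :: "D_class set" where "D_A0 = {c_0, c_1, c_2, c_3}"
definition D_A0_bar :: "D_class set" where "D_A0_bar = {c_0, cb_1, cb_2, cb_3}"
definition D_A1 :: "D_class set" where "D_A1 = UNIV - {c_phi}"
definition D_A2 :: "D_class set" where "D_A2 = {c_2, c_3, c_0, cb_3, cb_2}"
definition D_A3 :: "D_class set" where "D_A3 = {c_3, c_0, cb_3}"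

definition D_bold_A :: "(D_class \<times> D_class) set" where
  "D_bold_A = {(c_phi, c_phi), (c_2, cb_2)} \<union> D_A0 \<times> {cb_1} \<union> {c_1} \<times> D_A0_bar"

definition D_bold_B :: "(D_class \<times> D_class) set" where
  "D_bold_B = (D_A1 \<times> {c_1} \<union> {cb_1} \<times> D_A1) \<union> (D_A2 \<times> {c_2} \<union> {cb_2} \<times> D_A2)
     \<union> (D_A3 \<times> {c_3} \<union> {cb_3} \<times> D_A3)"

definition D_energy :: "D_class \<Rightarrow> D_class \<Rightarrow> int" where
  "D_energy x y = (if (x, y) \<in> D_bold_A then 0 else if (x, y) \<in> D_bold_B then 2 else 1)"

text \<open>In both types, \<open>ground\<close> is left unspecified at weights that are not of level one.\<close>

fun D_ground :: "fundamental_weight \<Rightarrow> D_block set" where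
  "D_ground Lambda0 = D_J 0 \<union> {DW 0, DQ 0, DZ 1}"

definition D4_3 :: "(D_block, D_class) wall_pattern" where
  "D4_3 = \<lparr>colour = D_colour, column = D_column, sign = D_sign,
     permitted = (\<lambda>i c c'. True), energy = D_energy, ground = D_ground\<rparr>"

section \<open>Type \<open>G\<^sub>2\<^sup>(\<^sup>1\<^sup>)\<close>\<close>

datatype G_block = GZ int | GA int | GB int | GX int | GY int | GV int

fun G_row :: "G_block \<Rightarrow> int" where
  "G_row (GZ n) = 2 * n"
| "G_row (GA n) = 2 * n"
| "G_row (GB n) = 2 * n"
| "G_row (GX n) = 2 * n + 1"
| "G_row (GY n) = 2 * n + 1"
| "G_row (GV n) = 2 * n + 1"

fun G_colour :: "G_block \<Rightarrow> nat" where
  "G_colour (GZ n) = 0"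
| "G_colour (GA n) = 2"
| "G_colour (GB n) = 2"
| "G_colour (GX n) = 1"
| "G_colour (GY n) = 1"
| "G_colour (GV n) = 2"

definition G_J :: "int \<Rightarrow> G_block set" where
  "G_J n = {b. G_row b \<le> 2 * n - 1}"

datatype G_class = c'_1 | c'_2 | c'_3 | c'_4 | c'_5 | c'_6 | c'_7
  | cb'_7 | cb'_6 | cb'_5 | cb'_4 | cb'_3 | cb'_2 | cb'_1 | c'_0

fun G_column :: "G_class \<Rightarrow> int \<Rightarrow> G_block set" where
  "G_column c'_1 n = G_J n \<union> {GZ n, GA n, GB n, GX n, GZ (n + 1)}"
| "G_column c'_2 n = G_J n \<union> {GZ n, GA n, GB n, GX n, GY n, GZ (n + 1)}"
| "G_column c'_3 n = G_J n \<union> {GZ n}"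
| "G_column c'_4 n = G_J n \<union> {GZ n, GA n}"
| "G_column c'_5 n = G_J n \<union> {GZ n, GA n, GY n}"
| "G_column c'_6 n = G_J n \<union> {GZ n, GA n, GB n}"
| "G_column c'_7 n = G_J n \<union> {GZ n, GA n, GB n, GY n}"
| "G_column cb'_7 n = G_J n \<union> {GZ n, GA n, GY n, GV n}"
| "G_column cb'_6 n = G_J n \<union> {GZ n, GA n, GB n, GY n, GX n}"
| "G_column cb'_5 n = G_J n \<union> {GZ n, GA n, GB n, GY n, GV n}"
| "G_column cb'_4 n = G_J n"
| "G_column cb'_3 n = G_J n \<union> {GA n}"
| "G_column cb'_2 n = G_J n \<union> {GA n, GB n}"
| "G_column cb'_1 n = G_J n \<union> {GA n, GB n, GX n}"
| "G_column c'_0 n = G_J n \<union> {GA n, GB n, GX n, GZ (n + 1)}"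

definition G_sign :: "nat \<Rightarrow> G_class \<Rightarrow> nat \<times> nat" where
  "G_sign i c =
     (if i = 0 then
        (case c of c'_1 \<Rightarrow> (2, 0) | c'_2 \<Rightarrow> (1, 0) | c'_3 \<Rightarrow> (1, 0) | c'_4 \<Rightarrow> (1, 0)
         | c'_6 \<Rightarrow> (1, 0) | cb'_6 \<Rightarrow> (0, 1) | cb'_4 \<Rightarrow> (0, 1) | cb'_3 \<Rightarrow> (0, 1)
         | cb'_2 \<Rightarrow> (0, 1) | cb'_1 \<Rightarrow> (0, 2) | c'_0 \<Rightarrow> (1, 1) | _ \<Rightarrow> (0, 0))
      else if i = 1 then
        (case c of c'_1 \<Rightarrow> (0, 1) | c'_2 \<Rightarrow> (1, 0) | c'_4 \<Rightarrow> (0, 1) | c'_5 \<Rightarrow> (1, 0)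
         | c'_6 \<Rightarrow> (0, 2) | c'_7 \<Rightarrow> (1, 1) | cb'_6 \<Rightarrow> (2, 0) | cb'_5 \<Rightarrow> (0, 1)
         | cb'_4 \<Rightarrow> (1, 0) | cb'_2 \<Rightarrow> (0, 1) | cb'_1 \<Rightarrow> (1, 0) | _ \<Rightarrow> (0, 0))
      else if i = 2 then
        (case c of c'_2 \<Rightarrow> (0, 3) | c'_3 \<Rightarrow> (1, 2) | c'_4 \<Rightarrow> (2, 1) | c'_6 \<Rightarrow> (3, 0)
         | c'_5 \<Rightarrow> (0, 2) | cb'_7 \<Rightarrow> (1, 1) | cb'_5 \<Rightarrow> (2, 0) | cb'_6 \<Rightarrow> (0, 3)
         | cb'_4 \<Rightarrow> (1, 2) | cb'_3 \<Rightarrow> (2, 1) | cb'_2 \<Rightarrow> (3, 0) | _ \<Rightarrow> (0, 0))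
      else (0, 0))"

definition G_D0 :: "G_class set" where "G_D0 = {c'_1, c'_2, c'_3, c'_4, c'_5, cb'_7}"
definition G_D0_bar :: "G_class set" where
  "G_D0_bar = {cb'_1, cb'_2, cb'_3, cb'_4, cb'_5, cb'_7}"
definition G_D0' :: "G_class set" where "G_D0' = {c'_5, c'_7, cb'_6}"
definition G_D0'_bar :: "G_class set" where "G_D0'_bar = {c'_6, c'_7, cb'_5}"
definition G_D1 :: "G_class set" where "G_D1 = UNIV - {c'_0}"
definition G_D2 :: "G_class set" where "G_D2 = UNIV - {c'_0, c'_1, cb'_1}"
definition G_D3 :: "G_class set" where "G_D3 = {cb'_5, c'_6, c'_7, cb'_6, cb'_4, cb'_3}"
definition G_D3_bar :: "G_class set" where "G_D3_bar = {cb'_6, c'_5, c'_7, c'_6, c'_4, c'_3}"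
definition G_D4 :: "G_class set" where "G_D4 = G_D3 - {cb'_3}"
definition G_D4_bar :: "G_class set" where "G_D4_bar = G_D3_bar - {c'_3}"
definition G_D5 :: "G_class set" where "G_D5 = {cb'_6}"
definition G_D5_bar :: "G_class set" where "G_D5_bar = {c'_6}"
definition G_D6 :: "G_class set" where "G_D6 = {c'_6, c'_7, cb'_6}"

definition G_bold_X :: "(G_class \<times> G_class) set" where
  "G_bold_X = {(c'_0, c'_0)} \<union> G_D0 \<times> G_D0_bar \<union> {c'_1} \<times> G_D0' \<union> G_D0'_bar \<times> {cb'_1}"

definition G_bold_Y :: "(G_class \<times> G_class) set" where
  "G_bold_Y = (G_D1 \<times> {c'_1} \<union> {cb'_1} \<times> G_D1) \<union> (G_D2 \<times> {c'_2} \<union> {cb'_2} \<times> G_D2)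
     \<union> (G_D3 \<times> {c'_3} \<union> {cb'_3} \<times> G_D3_bar) \<union> (G_D4 \<times> {c'_4} \<union> {cb'_4} \<times> G_D4_bar)
     \<union> (G_D5 \<times> {c'_5} \<union> {cb'_5} \<times> G_D5_bar) \<union> (G_D6 \<times> {c'_6} \<union> {cb'_6} \<times> G_D6)"

definition G_energy :: "G_class \<Rightarrow> G_class \<Rightarrow> int" where
  "G_energy x y = (if (x, y) \<in> G_bold_X then 0 else if (x, y) \<in> G_bold_Y then 2 else 1)"

fun G_ground :: "fundamental_weight \<Rightarrow> G_block set" where
  "G_ground Lambda0 = G_J 0 \<union> {GA 0, GB 0, GX 0, GZ 1}"
| "G_ground Lambda2 = G_J 1 \<union> {GZ 1, GA 1, GY 1, GV 1}"

definition G2_1 :: "(G_block, G_class) wall_pattern" where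
  "G2_1 = \<lparr>colour = G_colour, column = G_column, sign = G_sign,
     permitted = (\<lambda>i c c'. \<not> (i = 2 \<and> (c = c'_7 \<or> c' = c'_7))),
     energy = G_energy, ground = G_ground\<rparr>"

end

(* Being reduced is a condition on pairs of adjacent columns: the energy of a pair prescribes the
   difference of their numbers of 0-blocks, hence their relative vertical position, and in this
   position the left column is always contained in the right one. If the left-most uncancelled
   plus lies in column k, then column k + 1 has at most as many pluses as column k has minuses,
   while column k has more pluses than column k - 1 has minuses. So on both pairs of columns the
   operator acts by the tensor product rule, under which the energy changes exactly as the
   difference of the numbers of 0-blocks does. The right-most uncancelled minus is symmetric. *)
theory Submission
  imports Defs
begin

section \<open>Cancellation of signs between two neighbouring columns\<close>

section \<open>Signatures of adjacent columns\<close>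

text \<open>The string lengths \<open>\<epsilon>_i\<close> and \<open>\<phi>_i\<close> of crystal
  theory, attached to a column through its class.\<close>

definition eps :: "('b, 'c) wall_pattern \<Rightarrow> nat \<Rightarrow> 'b set \<Rightarrow> nat" where
  "eps P i y = fst (sign P i (class_of P y))"

definition phi :: "('b, 'c) wall_pattern \<Rightarrow> nat \<Rightarrow> 'b set \<Rightarrow> nat" where
  "phi P i y = snd (sign P i (class_of P y))"

lemma minus_at_iff: "minus_at P i Y (k, j) \<longleftrightarrow> j < eps P i (Y k)"
  by (simp add: minus_at_def eps_def split: prod.split)

lemma plus_at_iff:
  "plus_at P i Y (k, j) \<longleftrightarrow> eps P i (Y k) \<le> j \<and> j < eps P i (Y k) + phi P i (Y k)"
  by (simp add: plus_at_def eps_def phi_def split: prod.split)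

lemma left_of_iff [simp]: "left_of (k, j) (k', j') \<longleftrightarrow> k > k' \<or> (k = k' \<and> j < j')"
  by (simp add: left_of_def)

lemma cancelsD:
  assumes "cancels P i Y p q"
  shows "plus_at P i Y p" "minus_at P i Y q" "left_of p q"
    and "\<lbrakk>left_of p s; left_of s q; plus_at P i Y s \<or> minus_at P i Y s\<rbrakk> \<Longrightarrow>
      \<exists>t. left_of p t \<and> left_of t q \<and> (cancels P i Y s t \<or> cancels P i Y t s)"
proof -
  show "plus_at P i Y p" "minus_at P i Y q" "left_of p q"
    using assms by (auto elim: cancels.cases)
  show "\<exists>t. left_of p t \<and> left_of t q \<and> (cancels P i Y s t \<or> cancels P i Y t s)"
    if "left_of p s" "left_of s q" "plus_at P i Y s \<or> minus_at P i Y s"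
    using assms that by cases blast
qed

text \<open>Nested bracketing: \<open>t\<close> is a depth counted from the common border of the two
  columns. The signs enclosed by the pair at depth \<open>t\<close> are those of smaller depth,
  which the induction has already paired off.\<close>

lemma cancels_adjacent_depth:
  "\<lbrakk>t < phi P i (Y (Suc k)); t < eps P i (Y k)\<rbrakk> \<Longrightarrow>
    cancels P i Y (Suc k, eps P i (Y (Suc k)) + phi P i (Y (Suc k)) - Suc t) (k, t)"
proof (induction t rule: less_induct)
  case (less t)
  define r a where "r = eps P i (Y (Suc k))" and "a = phi P i (Y (Suc k))"
  have IH: "cancels P i Y (Suc k, r + a - Suc u) (k, u)" if "u < t" for u
    using less that by (simp add: r_def a_def)
  have ta: "t < a" using less.prems by (simp add: a_def)
  show ?case unfolding r_def[symmetric] a_def[symmetric]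
  proof (rule cancels.intros)
    show "plus_at P i Y (Suc k, r + a - Suc t)"
      using ta by (simp add: plus_at_iff r_def a_def)
    show "minus_at P i Y (k, t)" using less.prems by (simp add: minus_at_iff)
    show "left_of (Suc k, r + a - Suc t) (k, t)" by simp
    show "\<forall>s. left_of (Suc k, r + a - Suc t) s \<and> left_of s (k, t) \<and>
        (plus_at P i Y s \<or> minus_at P i Y s) \<longrightarrow>
      (\<exists>t'. left_of (Suc k, r + a - Suc t) t' \<and> left_of t' (k, t) \<and>
        (cancels P i Y s t' \<or> cancels P i Y t' s))"
    proof (intro allI impI)
      fix s
      assume s: "left_of (Suc k, r + a - Suc t) s \<and> left_of s (k, t) \<and>
        (plus_at P i Y s \<or> minus_at P i Y s)"
      obtain m j where [simp]: "s = (m, j)" by (cases s)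
      consider "m = Suc k" "j > r + a - Suc t" | "m = k" "j < t" using s by fastforce
      then show "\<exists>t'. left_of (Suc k, r + a - Suc t) t' \<and> left_of t' (k, t) \<and>
        (cancels P i Y s t' \<or> cancels P i Y t' s)"
      proof cases
        case 1
        have "j < r + a"
          using s 1 by (auto simp: plus_at_iff minus_at_iff r_def a_def)
        then have u: "r + a - Suc j < t" "r + a - Suc (r + a - Suc j) = j"
          using 1 ta by auto
        then show ?thesis using IH[OF u(1)] 1
          by (intro exI[of _ "(k, r + a - Suc j)"]) auto
      next
        case 2
        then show ?thesis using IH[of j] ta
          by (intro exI[of _ "(Suc k, r + a - Suc j)"]) auto
      qed
    qed
  qed
qed

text \<open>Whatever a cancelled pair encloses is cancelled inside it, by pairs joining the same two
  columns at smaller depths, which agree by induction. If \<open>j\<close> and \<open>t\<close>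
  differed, the enclosed sign of depth \<open>min j t\<close> would have no partner left.\<close>

lemma cancels_adjacent_unique:
  assumes "cancels P i Y (Suc k, eps P i (Y (Suc k)) + phi P i (Y (Suc k)) - Suc t) (k, j)"
    and "t < phi P i (Y (Suc k))"
  shows "j = t"
  using assms
proof (induction "j + t" arbitrary: j t rule: less_induct)
  case less
  define r a where "r = eps P i (Y (Suc k))" and "a = phi P i (Y (Suc k))"
  have c: "cancels P i Y (Suc k, r + a - Suc t) (k, j)" and ta: "t < a"
    using less.prems by (simp_all add: r_def a_def)
  have IH: "j' = t'"
    if "cancels P i Y (Suc k, r + a - Suc t') (k, j')" "t' < a" "j' + t' < j + t" for j' t'
    using less.hyps[of j' t'] that by (simp add: r_def a_def)
  have inner: "\<exists>j' t'. cancels P i Y (Suc k, r + a - Suc t') (k, j') \<and> j' < j \<and> t' < t \<and>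
      (s = (Suc k, r + a - Suc t') \<or> s = (k, j'))"
    if s: "left_of (Suc k, r + a - Suc t) s" "left_of s (k, j)"
      "plus_at P i Y s \<or> minus_at P i Y s" for s
  proof -
    obtain q where q: "left_of (Suc k, r + a - Suc t) q" "left_of q (k, j)"
      "cancels P i Y s q \<or> cancels P i Y q s"
      using cancelsD(4)[OF c s] by blast
    then obtain p m where pm: "cancels P i Y p m"
      "left_of (Suc k, r + a - Suc t) p" "left_of p (k, j)"
      "left_of (Suc k, r + a - Suc t) m" "left_of m (k, j)" "s = p \<or> s = m"
      using s by blast
    obtain k1 j1 k2 j2 where [simp]: "p = (k1, j1)" "m = (k2, j2)" by (cases p, cases m)
    note pm' = cancelsD(1-3)[OF pm(1)]
    \<comment> \<open>Minuses precede pluses within a column, so no minus of column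
      \<open>Suc k\<close> lies right of the outer plus, and no plus of column \<open>k\<close> lies
      left of a minus of that column.\<close>
    have "k2 = k" using pm pm' ta
      by (auto simp: plus_at_iff minus_at_iff r_def a_def not_less_eq less_Suc_eq)
    have "k1 = Suc k"
      using pm pm' \<open>k2 = k\<close> by (auto simp: plus_at_iff minus_at_iff less_Suc_eq)
    have j1: "j1 < r + a" "r + a - Suc t < j1"
      using pm pm' \<open>k1 = Suc k\<close> by (auto simp: plus_at_iff r_def a_def)
    have j2: "j2 < j" using pm \<open>k2 = k\<close> by simp
    show ?thesis
      using pm j1 j2 \<open>k2 = k\<close> \<open>k1 = Suc k\<close>
      by (intro exI[of _ j2] exI[of _ "r + a - Suc j1"]) auto
  qed
  show "j = t"
  proof (rule linorder_cases[of j t])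
    assume "j < t"
    then have "\<exists>j' t'. cancels P i Y (Suc k, r + a - Suc t') (k, j') \<and> j' < j \<and> t' < t \<and>
      ((Suc k, r + a - Suc j) = (Suc k, r + a - Suc t') \<or> (Suc k, r + a - Suc j) = (k, j'))"
      using ta by (intro inner) (auto simp: plus_at_iff r_def a_def)
    then obtain j' t' where "cancels P i Y (Suc k, r + a - Suc t') (k, j')" "j' < j" "t' < t"
      "r + a - Suc j = r + a - Suc t'" by auto
    moreover from this have "j = t'" using ta \<open>j < t\<close> by linarith
    ultimately show ?thesis using IH[of t' j'] ta by auto
  next
    assume "t < j"
    then have "\<exists>j' t'. cancels P i Y (Suc k, r + a - Suc t') (k, j') \<and> j' < j \<and> t' < t \<and>
      ((k, t) = (Suc k, r + a - Suc t') \<or> (k, t) = (k, j'))"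
      using cancelsD(2)[OF c] by (intro inner) (auto simp: minus_at_iff)
    then obtain j' t' where "cancels P i Y (Suc k, r + a - Suc t') (k, t)" "t' < t"
      by auto
    then show ?thesis using IH[of t' t] ta \<open>t < j\<close> by auto
  qed auto
qed

text \<open>The left-most plus of column \<open>Suc k\<close> is cancelled, but not beyond column
  \<open>k\<close>, since the pair would enclose the uncancelled plus there. So column
  \<open>k\<close> has a minus as deep as this deepest plus.\<close>

lemma phi_le_eps_if_no_signature_plus:
  assumes "signature_plus P i Y k" "\<not> signature_plus P i Y (Suc k)"
  shows "phi P i (Y (Suc k)) \<le> eps P i (Y k)"
proof (cases "phi P i (Y (Suc k)) = 0")
  case False
  define a where "a = phi P i (Y (Suc k))"
  obtain j where j: "plus_at P i Y (k, j)" "\<nexists>q. cancels P i Y (k, j) q"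
    using assms(1) by (auto simp: signature_plus_def)
  have "plus_at P i Y (Suc k, eps P i (Y (Suc k)))"
    using False by (simp add: plus_at_iff)
  then obtain q where q: "cancels P i Y (Suc k, eps P i (Y (Suc k))) q"
    using assms(2) unfolding signature_plus_def by blast
  obtain m l where [simp]: "q = (m, l)" by (cases q)
  have "\<not> m < k"
    using cancelsD(4)[OF q, of "(k, j)"] j
    by (auto simp: plus_at_iff minus_at_iff dest!: cancelsD(2)[where q = "(k, j)"])
  then have "m = k"
    using cancelsD(2,3)[OF q] by (auto simp: minus_at_iff)
  then have "l = a - 1"
    using cancels_adjacent_unique[of P i Y k "a - 1" l] q False by (simp add: a_def)
  then show ?thesis
    using cancelsD(2)[OF q] \<open>m = k\<close> by (simp add: minus_at_iff a_def)
qed simp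

text \<open>Otherwise each plus of column \<open>Suc k\<close> would be cancelled by the minus of
  equal depth in column \<open>k\<close>.\<close>

lemma eps_less_phi_if_signature_plus:
  assumes "signature_plus P i Y (Suc k)"
  shows "eps P i (Y k) < phi P i (Y (Suc k))"
proof (rule ccontr)
  assume "\<not> ?thesis"
  moreover obtain j where j: "plus_at P i Y (Suc k, j)" "\<nexists>q. cancels P i Y (Suc k, j) q"
    using assms by (auto simp: signature_plus_def)
  moreover define t where "t = eps P i (Y (Suc k)) + phi P i (Y (Suc k)) - Suc j"
  ultimately have "t < phi P i (Y (Suc k))" "t < eps P i (Y k)"
    and "eps P i (Y (Suc k)) + phi P i (Y (Suc k)) - Suc t = j"
    by (auto simp: plus_at_iff)
  then show False using cancels_adjacent_depth[of t P i Y k] j by auto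
qed

text \<open>Mirror image of \<open>phi_le_eps_if_no_signature_plus\<close>: the right-most minus of
  column \<open>k\<close> is cancelled without enclosing the uncancelled minus of column
  \<open>Suc k\<close>.\<close>

lemma eps_le_phi_if_no_signature_minus:
  assumes "signature_minus P i Y (Suc k)" "\<not> signature_minus P i Y k"
  shows "eps P i (Y k) \<le> phi P i (Y (Suc k))"
proof (cases "eps P i (Y k) = 0")
  case False
  define r a where "r = eps P i (Y (Suc k))" and "a = phi P i (Y (Suc k))"
  obtain j where j: "minus_at P i Y (Suc k, j)" "\<nexists>p. cancels P i Y p (Suc k, j)"
    using assms(1) by (auto simp: signature_minus_def)
  have "minus_at P i Y (k, eps P i (Y k) - 1)"
    using False by (simp add: minus_at_iff)
  then obtain p where p: "cancels P i Y p (k, eps P i (Y k) - 1)"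
    using assms(2) unfolding signature_minus_def by blast
  obtain m l where [simp]: "p = (m, l)" by (cases p)
  have "\<not> m > Suc k"
    using cancelsD(4)[OF p, of "(Suc k, j)"] j
    by (auto simp: plus_at_iff minus_at_iff dest!: cancelsD(1)[where p = "(Suc k, j)"])
  then have m: "m = Suc k"
    using cancelsD(1,3)[OF p] by (auto simp: plus_at_iff)
  then have l: "r \<le> l" "l < r + a"
    using cancelsD(1)[OF p] by (auto simp: plus_at_iff r_def a_def)
  then have "eps P i (Y k) - 1 = r + a - Suc l"
    using cancels_adjacent_unique[of P i Y k "r + a - Suc l" "eps P i (Y k) - 1"] p m
    by (simp add: a_def r_def)
  then show ?thesis using l by (simp add: a_def)
qed simp

lemma phi_less_eps_if_signature_minus:
  assumes "signature_minus P i Y k"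
  shows "phi P i (Y (Suc k)) < eps P i (Y k)"
proof (rule ccontr)
  assume "\<not> ?thesis"
  moreover obtain j where j: "minus_at P i Y (k, j)" "\<nexists>p. cancels P i Y p (k, j)"
    using assms by (auto simp: signature_minus_def)
  ultimately show False
    using cancels_adjacent_depth[of j P i Y k] by (auto simp: minus_at_iff)
qed

section \<open>Walls over an abstract pattern whose classes form a crystal with an energy
  function\<close>

section \<open>Regular patterns\<close>

text \<open>\<open>step i c = Some (c', s)\<close> records that adding an \<open>i\<close>-block leads from \<open>column P c n\<close> to
  \<open>column P c' (n + s)\<close>. The rules \<open>energy_step_right\<close> and \<open>energy_step_left\<close> say that \<open>energy\<close> is
  an energy function on the tensor square of the crystal of classes.\<close>

locale regular_pattern =
  fixes P :: "('b, 'c) wall_pattern"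
    and height :: "'c \<Rightarrow> int \<Rightarrow> int"
    and step :: "nat \<Rightarrow> 'c \<Rightarrow> ('c \<times> int) option"
  assumes column_inject: "column P c n = column P c' n' \<Longrightarrow> c = c' \<and> n = n'"
    and card_zero_blocks: "column P c n \<subseteq> column P c' n' \<Longrightarrow>
      int (card {b \<in> column P c' n' - column P c n. colour P b = 0}) = height c' n' - height c n"
    and insert_block_iff_step:
      "(\<exists>b. b \<notin> column P c n \<and> colour P b = i \<and> column P c' n' = insert b (column P c n)) \<and>
        permitted P i c c' \<longleftrightarrow> step i c = Some (c', n' - n)"
    and step_inject: "\<lbrakk>step i c = Some (d, s); step i c' = Some (d, s')\<rbrakk> \<Longrightarrow> c = c' \<and> s = s'"
    and sign_step: "step i c = Some (c', s) \<Longrightarrow>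
      sign P i c = (r, a) \<Longrightarrow> a > 0 \<and> sign P i c' = (Suc r, a - 1)"
    and step_exists: "snd (sign P i c) > 0 \<Longrightarrow> \<exists>c' s. step i c = Some (c', s)"
    and step_exists_back: "fst (sign P i c') > 0 \<Longrightarrow> \<exists>c s. step i c = Some (c', s)"
    and column_mono: "height y m - height x n = energy P x y \<Longrightarrow> column P x n \<subseteq> column P y m"
    and energy_step_right: "\<lbrakk>step i y = Some (y', s); snd (sign P i x) \<le> fst (sign P i y)\<rbrakk> \<Longrightarrow>
      energy P x y' = energy P x y + of_bool (i = 0)"
    and energy_step_left: "\<lbrakk>step i x = Some (x', s); snd (sign P i x) > fst (sign P i y)\<rbrakk> \<Longrightarrow>
      energy P x' y = energy P x y - of_bool (i = 0)"
begin

lemma class_of_column [simp]: "class_of P (column P c n) = c"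
  unfolding class_of_def using column_inject by (intro the_equality) auto

text \<open>A column may contain infinitely many 0-blocks. The height is a normalised substitute:
  its differences count blocks by \<open>card_zero_blocks\<close>.\<close>

definition zeros :: "'b set \<Rightarrow> int" where
  "zeros y = (THE h. \<exists>c n. y = column P c n \<and> h = height c n)"

lemma zeros_column [simp]: "zeros (column P c n) = height c n"
  unfolding zeros_def using column_inject by (intro the_equality) auto

lemma young_column_column [simp]: "young_column P (column P c n)"
  by (auto simp: young_column_def)

lemma block_step_iff:
  "block_step P i (column P c n) (column P c' n') \<longleftrightarrow> step i c = Some (c', n' - n)"
  using insert_block_iff_step[of c n i c' n'] by (simp add: block_step_def)

lemma block_stepE:
  assumes "block_step P i y y'"
  obtains c n c' s where "y = column P c n" "y' = column P c' (n + s)" "step i c = Some (c', s)"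
proof -
  obtain c n c' n' where "y = column P c n" "y' = column P c' n'"
    using assms by (auto simp: block_step_def young_column_def)
  with that[of c n c' "n' - n"] show ?thesis using assms by (simp add: block_step_iff)
qed

lemma block_step_unique:
  assumes "block_step P i y y'" "block_step P i y y''"
  shows "y' = y''"
proof -
  obtain c n c' s where 1: "y = column P c n" "y' = column P c' (n + s)" "step i c = Some (c', s)"
    using assms(1) by (rule block_stepE)
  obtain d m d' t where 2: "y = column P d m" "y'' = column P d' (m + t)" "step i d = Some (d', t)"
    using assms(2) by (rule block_stepE)
  have "c = d \<and> n = m" using 1(1) 2(1) by (intro column_inject) simp
  then show ?thesis using 1 2 by simp
qed

lemma block_step_unique_back:
  assumes "block_step P i y y''" "block_step P i y' y''"
  shows "y = y'"
proof -
  obtain c n c' s where 1: "y = column P c n" "y'' = column P c' (n + s)" "step i c = Some (c', s)"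
    using assms(1) by (rule block_stepE)
  obtain d m d' t where 2: "y' = column P d m" "y'' = column P d' (m + t)" "step i d = Some (d', t)"
    using assms(2) by (rule block_stepE)
  have eq: "c' = d' \<and> n + s = m + t" using 1(2) 2(2) by (intro column_inject) simp
  then have "c = d \<and> s = t" using 1(3) 2(3) by (intro step_inject) simp_all
  then show ?thesis using 1(1) 2(1) eq by simp
qed

text \<open>\<open>add_block\<close> is a definite description: a plus sign supplies existence
  through \<open>step_exists\<close>, and \<open>block_step_unique\<close> supplies
  uniqueness.\<close>

lemma block_step_add_block:
  assumes "young_column P y" "phi P i y > 0"
  shows "block_step P i y (add_block P i y)"
proof -
  obtain c n where y: "y = column P c n" using assms(1) by (auto simp: young_column_def)
  then obtain c' s where "step i c = Some (c', s)"
    using step_exists[of i c] assms(2) by (auto simp: phi_def)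
  then have "block_step P i y (column P c' (n + s))" by (simp add: y block_step_iff)
  then show ?thesis unfolding add_block_def
    by (rule theI)
      (rule block_step_unique[OF _ \<open>block_step P i y (column P c' (n + s))\<close>])
qed

lemma block_step_remove_block:
  assumes "young_column P y" "eps P i y > 0"
  shows "block_step P i (remove_block P i y) y"
proof -
  obtain c n where y: "y = column P c n" using assms(1) by (auto simp: young_column_def)
  then obtain c' s where "step i c' = Some (c, s)"
    using step_exists_back[of i c] assms(2) by (auto simp: eps_def)
  then have "block_step P i (column P c' (n - s)) y" by (simp add: y block_step_iff)
  then show ?thesis unfolding remove_block_def
    by (rule theI)
      (rule block_step_unique_back[OF _ \<open>block_step P i (column P c' (n - s)) y\<close>])
qed

lemma zeros_block_step: "block_step P i y y' \<Longrightarrow> zeros y' = zeros y + of_bool (i = 0)"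
proof (elim block_stepE)
  fix c n c' s
  assume y: "y = column P c n" "y' = column P c' (n + s)" and st: "step i c = Some (c', s)"
  have "step i c = Some (c', n + s - n)" using st by simp
  then obtain b where b: "b \<notin> y" "colour P b = i" "y' = insert b y"
    unfolding insert_block_iff_step[symmetric] y by blast
  then have "{b' \<in> y' - y. colour P b' = 0} = (if i = 0 then {b} else {})" by auto
  then have "int (card {b' \<in> y' - y. colour P b' = 0}) = of_bool (i = 0)" by simp
  then show ?thesis using card_zero_blocks[of c n c' "n + s"] b(3)
    unfolding y zeros_column by (metis add.commute diff_add_cancel subset_insertI)
qed

lemma eps_phi_block_step:
  assumes "block_step P i y y'"
  shows "eps P i y' = Suc (eps P i y)" "phi P i y = Suc (phi P i y')"
  using assms
  by (auto elim!: block_stepE dest!: sign_step[OF _ surjective_pairing] simp: eps_def phi_def)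

lemma zero_count_eq:
  assumes "young_column P y" "young_column P (ground P lam)" "ground P lam \<subseteq> y"
  shows "zero_count P lam y = zeros y - zeros (ground P lam)"
proof -
  obtain c n c' n' where "y = column P c n" "ground P lam = column P c' n'"
    using assms(1,2) unfolding young_column_def by metis
  with assms(3) show ?thesis using card_zero_blocks[of c' n' c n] by (simp add: zero_count_def)
qed

text \<open>Reducedness of a pair with the ground state eliminated, which shifts both counts of
  0-blocks by the same constant.\<close>

definition balanced :: "'b set \<Rightarrow> 'b set \<Rightarrow> bool" where
  "balanced x y \<longleftrightarrow> energy P (class_of P x) (class_of P y) = zeros y - zeros x"

lemma balanced_subset:
  assumes "young_column P x" "young_column P y" "balanced x y"
  shows "x \<subseteq> y"
proof -
  obtain c n c' n' where "x = column P c n" "y = column P c' n'"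
    using assms(1,2) unfolding young_column_def by metis
  with assms(3) show ?thesis using column_mono[of c' n' c n] by (simp add: balanced_def)
qed

text \<open>The inequality is the tensor product rule's condition for acting on the right factor.
  Being an equivalence, the result serves additions in one direction and removals in the
  other.\<close>

lemma balanced_step_right:
  assumes "block_step P i y y'" "young_column P x" "phi P i x \<le> eps P i y"
  shows "balanced x y' \<longleftrightarrow> balanced x y"
proof -
  have "energy P (class_of P x) (class_of P y') = energy P (class_of P x) (class_of P y)
      + of_bool (i = 0)"
    using assms by (auto elim!: block_stepE simp: eps_def phi_def energy_step_right)
  then show ?thesis using zeros_block_step[OF assms(1)] by (auto simp: balanced_def)
qed

lemma balanced_step_left:
  assumes "block_step P i x x'" "young_column P y" "phi P i x > eps P i y"
  shows "balanced x' y \<longleftrightarrow> balanced x y"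
proof -
  have "energy P (class_of P x') (class_of P y) = energy P (class_of P x) (class_of P y)
      - of_bool (i = 0)"
    using assms by (auto elim!: block_stepE simp: eps_def phi_def energy_step_left)
  then show ?thesis using zeros_block_step[OF assms(1)] by (auto simp: balanced_def)
qed

text \<open>Balanced pairs are nested automatically, and a decreasing sequence that ends in the
  ground state contains it everywhere; so no containment needs to be demanded.\<close>

lemma reduced_walls_iff:
  assumes "young_column P (ground P lam)"
  shows "Y \<in> reduced_walls P lam \<longleftrightarrow> (\<forall>k. young_column P (Y k)) \<and>
    (\<exists>K. \<forall>k\<ge>K. Y k = ground P lam) \<and> (\<forall>k. balanced (Y (Suc k)) (Y k))"
    (is "_ \<longleftrightarrow> ?R")
proof
  assume "Y \<in> reduced_walls P lam"
  then have Y: "young_wall P lam Y"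
    and "energy P (class_of P (Y (Suc k))) (class_of P (Y k))
          + zero_count P lam (Y (Suc k)) - zero_count P lam (Y k) = 0" for k
    by (auto simp: reduced_walls_def)
  moreover have "zero_count P lam (Y k) = zeros (Y k) - zeros (ground P lam)" for k
    using Y assms by (intro zero_count_eq) (auto simp: young_wall_def)
  ultimately show ?R by (auto simp: young_wall_def balanced_def algebra_simps)
next
  assume R: ?R
  then obtain K where K: "\<And>k. k \<ge> K \<Longrightarrow> Y k = ground P lam" by blast
  have mono: "Y (Suc k) \<subseteq> Y k" for k using R balanced_subset by blast
  have ground: "ground P lam \<subseteq> Y k" for k
    using lift_Suc_antimono_le[of Y k "max k K"] mono K[of "max k K"] by auto
  have "zero_count P lam (Y k) = zeros (Y k) - zeros (ground P lam)" for k
    using R assms ground by (intro zero_count_eq) auto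
  then show "Y \<in> reduced_walls P lam"
    using R mono ground by (auto simp: reduced_walls_def young_wall_def balanced_def)
qed

text \<open>Only the pairs containing column \<open>k\<close> change. Column \<open>0\<close> has no
  right neighbour, hence the conditional hypothesis.\<close>

lemma reduced_walls_update:
  assumes g: "young_column P (ground P lam)" and Y: "Y \<in> reduced_walls P lam"
    and y: "young_column P y" "balanced (Y (Suc k)) y" "\<And>j. k = Suc j \<Longrightarrow> balanced y (Y j)"
  shows "Y(k := y) \<in> reduced_walls P lam"
  unfolding reduced_walls_iff[OF g]
proof (intro conjI allI)
  note Y = Y[unfolded reduced_walls_iff[OF g]]
  show "young_column P ((Y(k := y)) j)" for j using Y y(1) by simp
  obtain K where "\<forall>k\<ge>K. Y k = ground P lam" using Y by blast
  then have "\<forall>j\<ge>max K (Suc k). (Y(k := y)) j = ground P lam" by auto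
  then show "\<exists>K. \<forall>j\<ge>K. (Y(k := y)) j = ground P lam" by blast
  show "balanced ((Y(k := y)) (Suc j)) ((Y(k := y)) j)" for j
    using Y y(2,3) by auto
qed

lemma E_tilde_reduced_walls:
  assumes g: "young_column P (ground P lam)" and Y: "Y \<in> reduced_walls P lam"
  shows "E_tilde P i Y \<in> Some ` reduced_walls P lam \<union> {None}"
proof (cases "\<exists>k. signature_minus P i Y k")
  case True
  define k where "k = (LEAST k. signature_minus P i Y k)"
  define y where "y = remove_block P i (Y k)"
  have k: "signature_minus P i Y k" "\<And>j. j < k \<Longrightarrow> \<not> signature_minus P i Y j"
    using True by (auto simp: k_def intro: LeastI dest: not_less_Least)
  have col: "young_column P (Y j)" and bal: "balanced (Y (Suc j)) (Y j)" for j
    using g Y by (auto simp: reduced_walls_iff)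
  note less = phi_less_eps_if_signature_minus[OF k(1)]
  then have st: "block_step P i y (Y k)"
    unfolding y_def using col by (intro block_step_remove_block) auto
  have "Y(k := y) \<in> reduced_walls P lam"
  proof (rule reduced_walls_update[OF g Y])
    show "young_column P y" using st by (simp add: block_step_def)
    \<comment> \<open>The rule is applied to the smaller column \<open>y\<close>, whose
      \<open>eps\<close> is one less than that of \<open>Y k\<close>: the strict inequality
      \<open>less\<close> becomes the weak one needed. Below, \<open>phi\<close> grows by one and
      turns a weak inequality into a strict one.\<close>
    show "balanced (Y (Suc k)) y"
      using balanced_step_right[OF st col, of "Suc k"] less eps_phi_block_step(1)[OF st] bal by auto
    show "balanced y (Y j)" if "k = Suc j" for j
      using balanced_step_left[OF st col, of j] eps_le_phi_if_no_signature_minus[of P i Y j]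
        eps_phi_block_step(2)[OF st] k bal[of j] that by auto
  qed
  then show ?thesis using True by (auto simp: E_tilde_def Let_def k_def y_def)
qed (simp add: E_tilde_def)

lemma F_tilde_reduced_walls:
  assumes g: "young_column P (ground P lam)" and Y: "Y \<in> reduced_walls P lam"
    and gs: "phi P i (ground P lam) \<le> eps P i (ground P lam)"
  shows "F_tilde P i Y \<in> Some ` reduced_walls P lam \<union> {None}"
proof (cases "\<exists>k. signature_plus P i Y k")
  case True
  define k where "k = (GREATEST k. signature_plus P i Y k)"
  define y where "y = add_block P i (Y k)"
  have col: "young_column P (Y j)" and bal: "balanced (Y (Suc j)) (Y j)" for j
    using g Y by (auto simp: reduced_walls_iff)
  obtain K where K: "\<And>k. k \<ge> K \<Longrightarrow> Y k = ground P lam"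
    using g Y by (auto simp: reduced_walls_iff)
  \<comment> \<open>\<open>GREATEST\<close> needs a bound. In the tail, \<open>gs\<close> provides a
    facing minus for every plus, so no plus survives there.\<close>
  have bound: "j \<le> K" if "signature_plus P i Y j" for j
  proof (rule ccontr)
    assume "\<not> j \<le> K"
    then obtain j' where "j = Suc j'" "j' \<ge> K" by (cases j) auto
    then show False
      using eps_less_phi_if_signature_plus[of P i Y j'] that gs K[of j'] K[of "Suc j'"] by auto
  qed
  have k: "signature_plus P i Y k" "\<not> signature_plus P i Y (Suc k)"
    using GreatestI_ex_nat[of "signature_plus P i Y" K, OF True bound]
      Greatest_le_nat[of "signature_plus P i Y" "Suc k" K] bound
    by (auto simp: k_def)
  have "phi P i (Y k) > 0"
    using k(1) by (auto simp: signature_plus_def plus_at_iff)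
  then have st: "block_step P i (Y k) y"
    unfolding y_def using col by (intro block_step_add_block) auto
  have "Y(k := y) \<in> reduced_walls P lam"
  proof (rule reduced_walls_update[OF g Y])
    show "young_column P y" using st by (simp add: block_step_def)
    show "balanced (Y (Suc k)) y"
      using balanced_step_right[OF st col, of "Suc k"] phi_le_eps_if_no_signature_plus[OF k] bal
      by auto
    show "balanced y (Y j)" if "k = Suc j" for j
      using balanced_step_left[OF st col, of j] eps_less_phi_if_signature_plus[of P i Y j]
        k bal[of j] that by auto
  qed
  then show ?thesis using True by (auto simp: F_tilde_def Let_def k_def y_def)
qed (simp add: F_tilde_def)

end

section \<open>Relative counts for infinite sets\<close>

section \<open>Cardinalities of filtered sets\<close>

text \<open>As a rewrite rule it peels off listed blocks one at a time, so that counts evaluate by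
  simplification.\<close>

lemma filter_insert_Diff:
  "{x \<in> insert a A - J. Q x} =
    (if a \<notin> J \<and> Q a then insert a {x \<in> A - J. Q x} else {x \<in> A - J. Q x})"
  by auto

lemma finite_filter_Diff:
  assumes "finite (A - B)"
  shows "finite {x \<in> A. x \<notin> B \<and> Q x}"
  using assms by (rule rev_finite_subset) auto

text \<open>\<open>A\<close> and \<open>B\<close> may be infinite, so both are measured above a
  common part \<open>J\<close>.\<close>

lemma card_filter_Diff:
  assumes "A \<subseteq> B" "J \<subseteq> A" "finite (B - J)"
  shows "int (card {x \<in> B - A. Q x}) = int (card {x \<in> B - J. Q x}) - int (card {x \<in> A - J. Q x})"
proof -
  have "{x \<in> B - J. Q x} = {x \<in> B - A. Q x} \<union> {x \<in> A - J. Q x}" using assms by auto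
  moreover have "finite {x \<in> B - A. Q x}" "finite {x \<in> A - J. Q x}"
    using assms by (auto intro: finite_subset[OF _ assms(3)])
  ultimately show ?thesis by (simp add: card_Un_disjnt disjnt_iff card_Un_disjoint Int_def)
qed

section \<open>The eight classes of type D: arrows and block counts\<close>

section \<open>Type \<open>D\<^sub>4\<^sup>(\<^sup>3\<^sup>)\<close>\<close>

text \<open>The shift is 1 exactly when the new block completes the rows \<open>2 * n\<close> and
  \<open>2 * n + 1\<close>.\<close>

definition D_step :: "nat \<Rightarrow> D_class \<Rightarrow> (D_class \<times> int) option" where
  "D_step i c =
     (if i = 0 then
       (case c of cb_3 \<Rightarrow> Some (c_2, 0) | cb_2 \<Rightarrow> Some (c_3, 0) | cb_1 \<Rightarrow> Some (c_phi, 0)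
         | c_phi \<Rightarrow> Some (c_1, 0) | _ \<Rightarrow> None)
     else if i = 1 then
       (case c of c_1 \<Rightarrow> Some (c_2, 1) | c_3 \<Rightarrow> Some (c_0, 0) | c_0 \<Rightarrow> Some (cb_3, 1)
         | cb_2 \<Rightarrow> Some (cb_1, 0) | _ \<Rightarrow> None)
     else if i = 2 then
       (case c of c_2 \<Rightarrow> Some (c_3, 0) | cb_3 \<Rightarrow> Some (cb_2, 0) | _ \<Rightarrow> None)
      else None)"

text \<open>\<open>D_count i c\<close> is the number of \<open>i\<close>-blocks of \<open>D_column c n\<close> outside \<open>D_J n\<close>; the height of a
  column is normalised so that \<open>D_J 0\<close> has height \<open>0\<close>.\<close>

definition D_count :: "nat \<Rightarrow> D_class \<Rightarrow> int" where
  "D_count i c =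
     (if i = 0 then
       (case c of c_1 \<Rightarrow> 2 | cb_3 \<Rightarrow> 0 | cb_2 \<Rightarrow> 0 | cb_1 \<Rightarrow> 0 | _ \<Rightarrow> 1)
     else if i = 1 then
       (case c of c_1 \<Rightarrow> 1 | c_0 \<Rightarrow> 1 | cb_1 \<Rightarrow> 1 | c_phi \<Rightarrow> 1 | _ \<Rightarrow> 0)
     else if i = 2 then
       (case c of c_2 \<Rightarrow> 0 | cb_3 \<Rightarrow> 0 | _ \<Rightarrow> 1)
      else 0)"

definition D_height :: "nat \<Rightarrow> D_class \<Rightarrow> int \<Rightarrow> int" where
  "D_height i c n = (if i = 0 then 1 else if i = 1 then 2 else 1) * n + D_count i c"

text \<open>Makes the search for the source of an arrow with known target a finite check.\<close>

lemma D_class_ex: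
  "(\<exists>c. Q c) \<longleftrightarrow>
    Q c_1 \<or> Q c_2 \<or> Q c_3 \<or> Q c_0 \<or> Q cb_3 \<or> Q cb_2 \<or> Q cb_1 \<or> Q c_phi" (is "_ \<longleftrightarrow> ?R")
proof
  assume "\<exists>c. Q c"
  then obtain c where "Q c" ..
  then show ?R by (cases c) simp_all
qed blast

lemma D_J_add_1: "D_J (n + 1) = D_J n \<union> {DZ n, DW n, DP n, DQ n}"
proof (rule set_eqI)
  show "b \<in> D_J (n + 1) \<longleftrightarrow> b \<in> D_J n \<union> {DZ n, DW n, DP n, DQ n}" for b
    by (cases b) (auto simp: D_J_def)
qed

lemma D_J_mono: "m \<le> n \<Longrightarrow> D_J m \<subseteq> D_J n"
  by (auto simp: D_J_def)

lemma D_mem_J [simp]: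
  "DZ k \<in> D_J n \<longleftrightarrow> k < n"
  "DW k \<in> D_J n \<longleftrightarrow> k < n"
  "DP k \<in> D_J n \<longleftrightarrow> k < n"
  "DQ k \<in> D_J n \<longleftrightarrow> k < n"
  by (auto simp: D_J_def)

lemma D_card_J:
  assumes "m \<le> n"
  shows "finite (D_J n - D_J m) \<and>
    int (card {b \<in> D_J n - D_J m. D_colour b = 0}) = n - m \<and>
    int (card {b \<in> D_J n - D_J m. D_colour b = Suc 0}) = 2 * (n - m) \<and>
    int (card {b \<in> D_J n - D_J m. D_colour b = 2}) = n - m"
  using assms
proof (induction n rule: int_ge_induct)
  case (step n)
  have [simp]: "b \<notin> D_J m \<and> b \<notin> D_J n" if "b \<in> {DZ n, DW n, DP n, DQ n}" for b
    using step.hyps that by (auto simp: D_J_def)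
  show ?case using step.IH
    unfolding D_J_add_1 Un_insert_right Un_empty_right filter_insert_Diff
    by (simp add: insert_Diff_if finite_filter_Diff)
qed simp

text \<open>The block \<open>DZ (n + 1)\<close> lies in row \<open>2 * n + 2\<close>, above
  \<open>D_J (n + 1)\<close>; hence the 2.\<close>

lemma D_column_bounds: "D_J n \<subseteq> D_column c n \<and> D_column c n \<subseteq> D_J (n + 2)"
  by (cases c) (auto simp: D_J_def)

lemma D_card_column_Diff_J:
  assumes "m \<le> n" "i \<in> {0, 1, 2}"
  shows "int (card {b \<in> D_column c n - D_J m. D_colour b = i}) = D_height i c n
    - (if i = 0 then 1 else if i = 1 then 2 else 1) * m"
proof -
  have [simp]: "b \<notin> D_J m \<and> b \<notin> D_J n"
    if "b \<in> {DZ n, DW n, DP n, DQ n} \<union> {DZ (n + 1)}" for b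
    using assms(1) that by (auto simp: D_J_def)
  note [simp] = D_height_def D_count_def
  consider "i = 0" | "i = 1" | "i = 2" using assms(2) by blast
  then show ?thesis using D_card_J[OF assms(1)]
    by cases (cases c; simp only: D_column.simps Un_insert_right Un_empty_right
      filter_insert_Diff;
      simp add: finite_filter_Diff)+
qed

lemma D_card_Diff:
  assumes "D_column c n \<subseteq> D_column c' n'" "i \<in> {0, 1, 2}"
  shows "int (card {b \<in> D_column c' n' - D_column c n. D_colour b = i})
    = D_height i c' n' - D_height i c n"
proof -
  \<comment> \<open>\<open>D_J m\<close> is contained in both columns, so both can be counted above
    it.\<close>
  define m where "m = min n n'"
  have m: "m \<le> n" "m \<le> n'" "n' + 2 \<ge> m" by (auto simp: m_def)
  have "finite (D_column c' n' - D_J m)"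
    using D_column_bounds[of n' c']
    by (intro finite_subset[OF _ conjunct1[OF D_card_J[OF m(3)]]]) auto
  then show ?thesis
    using card_filter_Diff[OF assms(1), of "D_J m" "\<lambda>b. D_colour b = i"]
      D_card_column_Diff_J[OF m(1) assms(2), of c] D_card_column_Diff_J[OF m(2) assms(2), of c']
      D_column_bounds[of n c] D_J_mono[OF m(1)] by auto
qed

lemma D_column_inject:
  assumes "D_column c n = D_column c' n'"
  shows "c = c' \<and> n = n'"
proof -
  have "D_height i c' n' = D_height i c n" if "i \<in> {0, 1, 2}" for i
    using D_card_Diff[of c n c' n' i] assms that by simp
  \<comment> \<open>Heights separate all classes except \<open>c_0\<close> and \<open>c_phi\<close>,
    which have equal counts but different blocks.\<close>
  from this[of 0] this[of 1] this[of 2] assms show ?thesis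
    by (cases c; cases c'; simp add: D_height_def D_count_def; force simp: D_J_def)
qed

text \<open>The new block raises the height of its own colour by one and no other. Candidates that
  this leaves besides the arrow fail containment.\<close>

lemma D_step_if_insert:
  assumes "b \<notin> D_column c n" "D_colour b = i" "D_column c' n' = insert b (D_column c n)"
    and "permitted D4_3 i c c'"
  shows "D_step i c = Some (c', n' - n)"
proof -
  have sub: "D_column c n \<subseteq> D_column c' n'" using assms by auto
  have diff: "{b' \<in> D_column c' n' - D_column c n. D_colour b' = j} =
    (if j = i then {b} else {})" for j
    using assms by auto
  then have eq: "D_height j c' n' - D_height j c n = of_bool (j = i)" if "j \<in> {0, 1, 2}" for j
    unfolding D_card_Diff[OF sub that, symmetric] diff by simp
  have "i \<in> {0, 1, 2}" using assms(2) by (cases b) auto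
  then consider "i = 0" | "i = 1" | "i = 2" by blast
  then show ?thesis
    using eq[of 0] eq[of 1] eq[of 2] sub assms(4)
    by cases (cases c; cases c'; simp add: D_height_def D_count_def D_step_def D4_3_def;
      force simp: D_J_def)+
qed

lemma D_insert_if_step:
  assumes "D_step i c = Some (c', s)"
  shows "(\<exists>b. b \<notin> D_column c n \<and> D_colour b = i \<and>
      D_column c' (n + s) = insert b (D_column c n)) \<and> permitted D4_3 i c c'"
proof -
  note [simp] = D_step_def D4_3_def D_J_add_1
  consider "i = 0" | "i = 1" | "i = 2" using assms by (auto split: if_splits)
  then show ?thesis using assms
    \<comment> \<open>Candidates for the new block; \<open>DZ (n + 1)\<close> belongs to the arrow
      from \<open>cb_1\<close> to \<open>c_phi\<close>.\<close>
    by cases (cases c; clarsimp; ((rule exI[of _ "DZ n"]; force simp: D_J_def)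
      | (rule exI[of _ "DW n"]; force simp: D_J_def)
      | (rule exI[of _ "DP n"]; force simp: D_J_def)
      | (rule exI[of _ "DQ n"]; force simp: D_J_def)
      | (rule exI[of _ "DZ (n + 1)"]; force simp: D_J_def)))+
qed

section \<open>The energy function of type D, by finite checks\<close>

lemmas D_energy_defs = D_energy_def D_A0_def D_A0_bar_def D_A1_def D_A2_def D_A3_def D_bold_A_def
  D_bold_B_def

lemma D_energy_step_right:
  assumes "D_step i y = Some (y', s)" "snd (D_sign i x) \<le> fst (D_sign i y)"
  shows "D_energy x y' = D_energy x y + of_bool (i = 0)"
proof -
  consider "i = 0" | "i = 1" | "i = 2" using assms(1) by (auto simp: D_step_def split: if_splits)
  then show ?thesis using assms
    by cases (cases y; clarsimp simp: D_step_def; cases x; simp add: D_sign_def D_energy_defs)+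
qed

lemma D_energy_step_left:
  assumes "D_step i x = Some (x', s)" "snd (D_sign i x) > fst (D_sign i y)"
  shows "D_energy x' y = D_energy x y - of_bool (i = 0)"
proof -
  consider "i = 0" | "i = 1" | "i = 2" using assms(1) by (auto simp: D_step_def split: if_splits)
  then show ?thesis using assms
    by cases (cases x; clarsimp simp: D_step_def; cases y; simp add: D_sign_def D_energy_defs)+
qed

text \<open>For fixed classes the equation determines \<open>m - n\<close>, and explicit sets remain
  to be compared.\<close>

lemma D_column_mono:
  assumes "D_height 0 y m - D_height 0 x n = D_energy x y"
  shows "D_column x n \<subseteq> D_column y m"
  using assms
  by (cases x; cases y;
    simp add: D_height_def D_count_def D_energy_defs D_J_mono subset_insertI2)

interpretation D: regular_pattern D4_3 "D_height 0" D_step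
proof
  show "c = c' \<and> n = n'" if "column D4_3 c n = column D4_3 c' n'" for c c' n n'
    using that D_column_inject by (simp add: D4_3_def)
  show "int (card {b \<in> column D4_3 c' n' - column D4_3 c n. colour D4_3 b = 0})
      = D_height 0 c' n' - D_height 0 c n"
    if "column D4_3 c n \<subseteq> column D4_3 c' n'" for c c' n n'
    using that D_card_Diff[of c n c' n' 0] by (simp add: D4_3_def)
  show "(\<exists>b. b \<notin> column D4_3 c n \<and> colour D4_3 b = i \<and>
        column D4_3 c' n' = insert b (column D4_3 c n)) \<and> permitted D4_3 i c c'
      \<longleftrightarrow> D_step i c = Some (c', n' - n)" for i c c' n n'
    using D_step_if_insert[of _ c n i c' n'] D_insert_if_step[of i c c' "n' - n" n]
    by (auto simp: D4_3_def)
  show "c = c' \<and> s = s'" if "D_step i c = Some (d, s)" "D_step i c' = Some (d, s')"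
    for i c c' d s s'
    using that by (cases c; cases c'; auto simp: D_step_def split: if_splits)
  show "a > 0 \<and> sign D4_3 i c' = (Suc r, a - 1)"
    if "D_step i c = Some (c', s)" "sign D4_3 i c = (r, a)" for i c c' s r a
    using that by (cases c; auto simp: D4_3_def D_sign_def D_step_def split: if_splits)
  show "\<exists>c' s. D_step i c = Some (c', s)" if "snd (sign D4_3 i c) > 0" for i c
    using that by (cases c; auto simp: D4_3_def D_sign_def D_step_def split: if_splits)
  show "\<exists>c s. D_step i c = Some (c', s)" if "fst (sign D4_3 i c') > 0" for i c'
    using that by (cases c') (auto simp: D4_3_def D_sign_def D_step_def D_class_ex split: if_splits)
qed (use D_column_mono D_energy_step_right D_energy_step_left in \<open>simp_all add: D4_3_def\<close>)

section \<open>The fifteen classes of type G, treated in parallel\<close>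

section \<open>Type \<open>G\<^sub>2\<^sup>(\<^sup>1\<^sup>)\<close>\<close>

text \<open>Two moves of colour 2 between Young columns are omitted, \<open>c'_5\<close> to
  \<open>c'_7\<close> by \<open>GB n\<close> and \<open>c'_7\<close> to \<open>cb'_5\<close> by
  \<open>GV n\<close>, in accordance with \<open>permitted\<close>. They would make adding to
  \<open>c'_5\<close> and removing from \<open>cb'_5\<close> ambiguous.\<close>

definition G_step :: "nat \<Rightarrow> G_class \<Rightarrow> (G_class \<times> int) option" where
  "G_step i c =
     (if i = 0 then
       (case c of cb'_6 \<Rightarrow> Some (c'_2, 0) | cb'_4 \<Rightarrow> Some (c'_3, 0) | cb'_3 \<Rightarrow> Some (c'_4, 0)
         | cb'_2 \<Rightarrow> Some (c'_6, 0) | cb'_1 \<Rightarrow> Some (c'_0, 0) | c'_0 \<Rightarrow> Some (c'_1, 0)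
         | _ \<Rightarrow> None)
     else if i = 1 then
       (case c of c'_1 \<Rightarrow> Some (c'_2, 0) | c'_4 \<Rightarrow> Some (c'_5, 0) | c'_6 \<Rightarrow> Some (c'_7, 0)
         | c'_7 \<Rightarrow> Some (cb'_6, 0) | cb'_5 \<Rightarrow> Some (cb'_4, 1) | cb'_2 \<Rightarrow> Some (cb'_1, 0)
         | _ \<Rightarrow> None)
     else if i = 2 then
       (case c of c'_2 \<Rightarrow> Some (c'_3, 1) | c'_3 \<Rightarrow> Some (c'_4, 0) | c'_4 \<Rightarrow> Some (c'_6, 0)
         | c'_5 \<Rightarrow> Some (cb'_7, 0) | cb'_7 \<Rightarrow> Some (cb'_5, 0) | cb'_6 \<Rightarrow> Some (cb'_4, 1)
         | cb'_4 \<Rightarrow> Some (cb'_3, 0) | cb'_3 \<Rightarrow> Some (cb'_2, 0) | _ \<Rightarrow> None)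
      else None)"

definition G_count :: "nat \<Rightarrow> G_class \<Rightarrow> int" where
  "G_count i c =
     (if i = 0 then
       (case c of c'_1 \<Rightarrow> 2 | c'_2 \<Rightarrow> 2 | cb'_4 \<Rightarrow> 0 | cb'_3 \<Rightarrow> 0 | cb'_2 \<Rightarrow> 0
         | cb'_1 \<Rightarrow> 0 | _ \<Rightarrow> 1)
     else if i = 1 then
       (case c of c'_2 \<Rightarrow> 2 | c'_3 \<Rightarrow> 0 | c'_4 \<Rightarrow> 0 | c'_6 \<Rightarrow> 0 | cb'_6 \<Rightarrow> 2
         | cb'_4 \<Rightarrow> 0 | cb'_3 \<Rightarrow> 0 | cb'_2 \<Rightarrow> 0 | _ \<Rightarrow> 1)
     else if i = 2 then
       (case c of c'_3 \<Rightarrow> 0 | c'_4 \<Rightarrow> 1 | c'_5 \<Rightarrow> 1 | cb'_5 \<Rightarrow> 3 | cb'_4 \<Rightarrow> 0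
         | cb'_3 \<Rightarrow> 1 | _ \<Rightarrow> 2)
      else 0)"

text \<open>The slopes 1, 2, 3 are the numbers of blocks of each colour in rows \<open>2 * n\<close>
  and \<open>2 * n + 1\<close>, the coefficients of the null root.\<close>

definition G_height :: "nat \<Rightarrow> G_class \<Rightarrow> int \<Rightarrow> int" where
  "G_height i c n = (if i = 0 then 1 else if i = 1 then 2 else 3) * n + G_count i c"

lemma G_class_ex:
  "(\<exists>c. Q c) \<longleftrightarrow>
    Q c'_1 \<or> Q c'_2 \<or> Q c'_3 \<or> Q c'_4 \<or> Q c'_5 \<or> Q c'_6 \<or> Q c'_7 \<or> Q cb'_7
    \<or> Q cb'_6 \<or> Q cb'_5 \<or> Q cb'_4 \<or> Q cb'_3 \<or> Q cb'_2 \<or> Q cb'_1 \<or> Q c'_0" (is "_ \<longleftrightarrow> ?R")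
proof
  assume "\<exists>c. Q c"
  then obtain c where "Q c" ..
  then show ?R by (cases c) simp_all
qed blast

lemma G_J_add_1: "G_J (n + 1) = G_J n \<union> {GZ n, GA n, GB n, GX n, GY n, GV n}"
proof (rule set_eqI)
  show "b \<in> G_J (n + 1) \<longleftrightarrow> b \<in> G_J n \<union> {GZ n, GA n, GB n, GX n, GY n, GV n}" for b
    by (cases b) (auto simp: G_J_def)
qed

lemma G_J_mono: "m \<le> n \<Longrightarrow> G_J m \<subseteq> G_J n"
  by (auto simp: G_J_def)

lemma G_mem_J [simp]:
  "GZ k \<in> G_J n \<longleftrightarrow> k < n"
  "GA k \<in> G_J n \<longleftrightarrow> k < n"
  "GB k \<in> G_J n \<longleftrightarrow> k < n"
  "GX k \<in> G_J n \<longleftrightarrow> k < n"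
  "GY k \<in> G_J n \<longleftrightarrow> k < n"
  "GV k \<in> G_J n \<longleftrightarrow> k < n"
  by (auto simp: G_J_def)

lemma G_card_J:
  assumes "m \<le> n"
  shows "finite (G_J n - G_J m) \<and>
    int (card {b \<in> G_J n - G_J m. G_colour b = 0}) = n - m \<and>
    int (card {b \<in> G_J n - G_J m. G_colour b = Suc 0}) = 2 * (n - m) \<and>
    int (card {b \<in> G_J n - G_J m. G_colour b = 2}) = 3 * (n - m)"
  using assms
proof (induction n rule: int_ge_induct)
  case (step n)
  have [simp]: "b \<notin> G_J m \<and> b \<notin> G_J n" if "b \<in> {GZ n, GA n, GB n, GX n, GY n, GV n}" for b
    using step.hyps that by (auto simp: G_J_def)
  show ?case using step.IH
    unfolding G_J_add_1 Un_insert_right Un_empty_right filter_insert_Diff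
    by (simp add: insert_Diff_if finite_filter_Diff)
qed simp

lemma G_column_bounds: "G_J n \<subseteq> G_column c n \<and> G_column c n \<subseteq> G_J (n + 2)"
  by (cases c) (auto simp: G_J_def)

lemma G_card_column_Diff_J:
  assumes "m \<le> n" "i \<in> {0, 1, 2}"
  shows "int (card {b \<in> G_column c n - G_J m. G_colour b = i}) = G_height i c n
    - (if i = 0 then 1 else if i = 1 then 2 else 3) * m"
proof -
  have [simp]: "b \<notin> G_J m \<and> b \<notin> G_J n"
    if "b \<in> {GZ n, GA n, GB n, GX n, GY n, GV n} \<union> {GZ (n + 1)}" for b
    using assms(1) that by (auto simp: G_J_def)
  note [simp] = G_height_def G_count_def
  consider "i = 0" | "i = 1" | "i = 2" using assms(2) by blast
  then show ?thesis using G_card_J[OF assms(1)]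
    by cases (cases c; simp only: G_column.simps Un_insert_right Un_empty_right
      filter_insert_Diff;
      simp add: finite_filter_Diff)+
qed

lemma G_card_Diff:
  assumes "G_column c n \<subseteq> G_column c' n'" "i \<in> {0, 1, 2}"
  shows "int (card {b \<in> G_column c' n' - G_column c n. G_colour b = i})
    = G_height i c' n' - G_height i c n"
proof -
  define m where "m = min n n'"
  have m: "m \<le> n" "m \<le> n'" "n' + 2 \<ge> m" by (auto simp: m_def)
  have "finite (G_column c' n' - G_J m)"
    using G_column_bounds[of n' c']
    by (intro finite_subset[OF _ conjunct1[OF G_card_J[OF m(3)]]]) auto
  then show ?thesis
    using card_filter_Diff[OF assms(1), of "G_J m" "\<lambda>b. G_colour b = i"]
      G_card_column_Diff_J[OF m(1) assms(2), of c] G_card_column_Diff_J[OF m(2) assms(2), of c']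
      G_column_bounds[of n c] G_J_mono[OF m(1)] by auto
qed

lemma G_column_inject:
  assumes "G_column c n = G_column c' n'"
  shows "c = c' \<and> n = n'"
proof -
  have "G_height i c' n' = G_height i c n" if "i \<in> {0, 1, 2}" for i
    using G_card_Diff[of c n c' n' i] assms that by simp
  \<comment> \<open>Here \<open>c'_7\<close>, \<open>cb'_7\<close> and \<open>c'_0\<close> share all
    three counts and are told apart by their blocks.\<close>
  from this[of 0] this[of 1] this[of 2] assms show ?thesis
    by (cases c; cases c'; simp add: G_height_def G_count_def; force simp: G_J_def)
qed

lemma G_step_if_insert:
  assumes "b \<notin> G_column c n" "G_colour b = i" "G_column c' n' = insert b (G_column c n)"
    and "permitted G2_1 i c c'"
  shows "G_step i c = Some (c', n' - n)"
proof -
  have sub: "G_column c n \<subseteq> G_column c' n'" using assms by auto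
  have diff: "{b' \<in> G_column c' n' - G_column c n. G_colour b' = j} =
    (if j = i then {b} else {})" for j
    using assms by auto
  then have eq: "G_height j c' n' - G_height j c n = of_bool (j = i)" if "j \<in> {0, 1, 2}" for j
    unfolding G_card_Diff[OF sub that, symmetric] diff by simp
  have "i \<in> {0, 1, 2}" using assms(2) by (cases b) auto
  then consider "i = 0" | "i = 1" | "i = 2" by blast
  \<comment> \<open>Counts and containment still allow the two omitted moves through
    \<open>c'_7\<close>; \<open>assms(4)\<close> excludes them.\<close>
  then show ?thesis
    using eq[of 0] eq[of 1] eq[of 2] sub assms(4)
    by cases (cases c; cases c'; simp add: G_height_def G_count_def G_step_def G2_1_def;
      force simp: G_J_def)+
qed

lemma G_insert_if_step:
  assumes "G_step i c = Some (c', s)"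
  shows "(\<exists>b. b \<notin> G_column c n \<and> G_colour b = i \<and>
      G_column c' (n + s) = insert b (G_column c n)) \<and> permitted G2_1 i c c'"
proof -
  note [simp] = G_step_def G2_1_def G_J_add_1
  consider "i = 0" | "i = 1" | "i = 2" using assms by (auto split: if_splits)
  then show ?thesis using assms
    \<comment> \<open>\<open>GZ (n + 1)\<close> belongs to the arrows from \<open>cb'_6\<close> to
      \<open>c'_2\<close> and from \<open>cb'_1\<close> to \<open>c'_0\<close>.\<close>
    by cases (cases c; clarsimp; ((rule exI[of _ "GZ n"]; force simp: G_J_def)
      | (rule exI[of _ "GA n"]; force simp: G_J_def)
      | (rule exI[of _ "GB n"]; force simp: G_J_def)
      | (rule exI[of _ "GX n"]; force simp: G_J_def)
      | (rule exI[of _ "GY n"]; force simp: G_J_def)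
      | (rule exI[of _ "GV n"]; force simp: G_J_def)
      | (rule exI[of _ "GZ (n + 1)"]; force simp: G_J_def)))+
qed

lemmas G_energy_defs = G_energy_def G_D0_def G_D0_bar_def G_D0'_def G_D0'_bar_def G_D1_def G_D2_def
  G_D3_def G_D3_bar_def G_D4_def G_D4_bar_def G_D5_def G_D5_bar_def G_D6_def
  G_bold_X_def G_bold_Y_def

lemma G_energy_step_right:
  assumes "G_step i y = Some (y', s)" "snd (G_sign i x) \<le> fst (G_sign i y)"
  shows "G_energy x y' = G_energy x y + of_bool (i = 0)"
proof -
  consider "i = 0" | "i = 1" | "i = 2" using assms(1) by (auto simp: G_step_def split: if_splits)
  then show ?thesis using assms
    by cases (cases y; clarsimp simp: G_step_def; cases x; simp add: G_sign_def G_energy_defs)+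
qed

lemma G_energy_step_left:
  assumes "G_step i x = Some (x', s)" "snd (G_sign i x) > fst (G_sign i y)"
  shows "G_energy x' y = G_energy x y - of_bool (i = 0)"
proof -
  consider "i = 0" | "i = 1" | "i = 2" using assms(1) by (auto simp: G_step_def split: if_splits)
  then show ?thesis using assms
    by cases (cases x; clarsimp simp: G_step_def; cases y; simp add: G_sign_def G_energy_defs)+
qed

lemma G_column_mono:
  assumes "G_height 0 y m - G_height 0 x n = G_energy x y"
  shows "G_column x n \<subseteq> G_column y m"
  using assms
  by (cases x; cases y;
    simp add: G_height_def G_count_def G_energy_defs G_J_mono subset_insertI2)

interpretation G: regular_pattern G2_1 "G_height 0" G_step
proof
  show "c = c' \<and> n = n'" if "column G2_1 c n = column G2_1 c' n'" for c c' n n'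
    using that G_column_inject by (simp add: G2_1_def)
  show "int (card {b \<in> column G2_1 c' n' - column G2_1 c n. colour G2_1 b = 0})
      = G_height 0 c' n' - G_height 0 c n"
    if "column G2_1 c n \<subseteq> column G2_1 c' n'" for c c' n n'
    using that G_card_Diff[of c n c' n' 0] by (simp add: G2_1_def)
  show "(\<exists>b. b \<notin> column G2_1 c n \<and> colour G2_1 b = i \<and>
        column G2_1 c' n' = insert b (column G2_1 c n)) \<and> permitted G2_1 i c c'
      \<longleftrightarrow> G_step i c = Some (c', n' - n)" for i c c' n n'
    using G_step_if_insert[of _ c n i c' n'] G_insert_if_step[of i c c' "n' - n" n]
    by (auto simp: G2_1_def)
  show "c = c' \<and> s = s'" if "G_step i c = Some (d, s)" "G_step i c' = Some (d, s')"
    for i c c' d s s'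
    using that by (cases c; cases c'; auto simp: G_step_def split: if_splits)
  show "a > 0 \<and> sign G2_1 i c' = (Suc r, a - 1)"
    if "G_step i c = Some (c', s)" "sign G2_1 i c = (r, a)" for i c c' s r a
    using that by (cases c; auto simp: G2_1_def G_sign_def G_step_def split: if_splits)
  show "\<exists>c' s. G_step i c = Some (c', s)" if "snd (sign G2_1 i c) > 0" for i c
    using that by (cases c; auto simp: G2_1_def G_sign_def G_step_def split: if_splits)
  show "\<exists>c s. G_step i c = Some (c', s)" if "fst (sign G2_1 i c') > 0" for i c'
    using that by (cases c') (auto simp: G2_1_def G_sign_def G_step_def G_class_ex split: if_splits)
qed (use G_column_mono G_energy_step_right G_energy_step_left in \<open>simp_all add: G2_1_def\<close>)

section \<open>Application to the three ground states\<close>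

section \<open>Closure under the Kashiwara operators\<close>

theorem proposition4p1:
  fixes i :: nat
  assumes "i \<in> {0, 1, 2}"
  shows "(\<forall>Y \<in> reduced_walls D4_3 Lambda0.
            E_tilde D4_3 i Y \<in> Some ` reduced_walls D4_3 Lambda0 \<union> {None} \<and>
            F_tilde D4_3 i Y \<in> Some ` reduced_walls D4_3 Lambda0 \<union> {None})
       \<and> (\<forall>lam \<in> {Lambda0, Lambda2}. \<forall>Y \<in> reduced_walls G2_1 lam.
            E_tilde G2_1 i Y \<in> Some ` reduced_walls G2_1 lam \<union> {None} \<and>
            F_tilde G2_1 i Y \<in> Some ` reduced_walls G2_1 lam \<union> {None})"
proof -
  have D_ground: "ground D4_3 Lambda0 = column D4_3 c_phi 0"
    by (simp add: D4_3_def)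
  have G_ground: "ground G2_1 Lambda0 = column G2_1 c'_0 0"
    "ground G2_1 Lambda2 = column G2_1 cb'_7 1"
    by (simp_all add: G2_1_def)
  have D_young: "young_column D4_3 (ground D4_3 Lambda0)"
    by (simp add: D_ground)
  \<comment> \<open>The class \<open>c_phi\<close> has signs \<open>(1, 1)\<close> for colour 0 and
    \<open>(0, 0)\<close> otherwise, so every plus in the tail faces a minus. Likewise
    \<open>c'_0\<close> for colour 0 and \<open>cb'_7\<close> for colour 2.\<close>
  have D_sign: "phi D4_3 i (ground D4_3 Lambda0) \<le> eps D4_3 i (ground D4_3 Lambda0)"
    unfolding phi_def eps_def D_ground D.class_of_column by (simp add: D4_3_def D_sign_def)
  have G_young: "young_column G2_1 (ground G2_1 lam)" if "lam \<in> {Lambda0, Lambda2}" for lam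
    using that by (auto simp: G_ground)
  have G_sign: "phi G2_1 i (ground G2_1 lam) \<le> eps G2_1 i (ground G2_1 lam)"
    if "lam \<in> {Lambda0, Lambda2}" for lam
    using that unfolding phi_def eps_def
    by (auto simp: G_ground) (simp_all add: G2_1_def G_sign_def)
  show ?thesis
    by (intro conjI ballI D.E_tilde_reduced_walls[OF D_young]
      D.F_tilde_reduced_walls[OF D_young _ D_sign]
      G.E_tilde_reduced_walls[OF G_young] G.F_tilde_reduced_walls[OF G_young _ G_sign])
qed

end
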